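(* Let $P$ follow a nonlinear semiparametric GLM DAG on a DAG $G$. Then $G$ is identifiable from $P$ within the class of nonlinear semiparametric GLM DAGs: if $P$ also follows a nonlinear semiparametric GLM DAG on a DAG $\widetilde G$ with the same vertex set, then $\widetilde G=G$.
   Context: $G=(V,E)$ is a DAG with $V=\{1,\dots,d\}$ and $\operatorname{Pa}_G(j)$ denotes the parents of $j$; a source is a node without parents. $X=(X_1,\dots,X_d)$ has law $P$. Each $X_j$ is continuous (support $\mathcal X_j\subseteq\mathbb R$ a connected interval with nonempty interior, $\nu_j$ Lebesgue measure, $\mathring{\mathcal X}_j=\operatorname{int}\mathcal X_j$) or count (support $\mathcal X_j$ a set of consecutive integers, bounded below, with at least three elements, $\nu_j$ counting measure, $\mathring{\mathcal X}_j=\mathcal X_j$). $p$ is the density of $P$ with respect to $\bigotimes_j\nu_j$ (densities include mass functions). For $A\subseteq V$, $\mathring{\mathcal X}_A=\prod_{i\in A}\mathring{\mathcal X}_i$. Semiparametric GLM DAG. $P$ follows a semiparametric GLM DAG on $G$ if $p(x)=\prod_jp_j(x_j\mid x_{\operatorname{Pa}_G(j)})$, where source marginal densities $p_j$ on $\mathcal X_j$ are arbitrary, and for every non-source $j$ $$p_j(x_j\mid x_{\operatorname{Pa}_G(j)})=b_j(x_j)\exp\{x_j\eta_j(x_{\operatorname{Pa}_G(j)})-A_j(\eta_j(x_{\operatorname{Pa}_G(j)}))\},\quad A_j(t)=\log\int_{\mathcal X_j}b_j(u)e^{ut}\,d\nu_j(u),$$ where $\mathcal X_j$ and $b_j$ do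 not depend on the parent values, and $\eta_j$ depends nontrivially (is nonconstant) in every parent coordinate on $\mathring{\mathcal X}_{\operatorname{Pa}_G(j)}$. It is nonlinear if for every edge $k\to i$ there are fixed values $z$ of the other parents of $i$ in the interior of their product support such that $\eta_i(\cdot,z)$ is not affine on $\mathring{\mathcal X}_k$. Regularity (part of the class). Densities are finite and strictly positive on product-support interiors. Source densities and base functions $b_j$ are finite and strictly positive on support interiors with logarithms $C^2$ in continuous coordinates. Each $\eta_j$ is finite and jointly $C^2$ in its continuous parent coordinates for each fixed choice of the count parents. $\eta_j(\mathring{\mathcal X}_{\operatorname{Pa}_G(j)})\subseteq\operatorname{int}\{t\in\mathbb R:A_j(t)<\infty\}$. *)

theory Defs
  imports "HOL-Probability.Probability"
begin

text \<open>
  A directed graph on the vertex set \<open>{1..d}\<close> is given by its edge relation, with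
  \<open>(k, j) \<in> E\<close> meaning \<open>k \<rightarrow> j\<close>. A point of a coordinate space indexed by a finite set \<open>A\<close>
  of vertices is an element of an extensional product \<open>PiE A\<close>; it carries the topology
  that \<open>nat \<Rightarrow> real\<close> induces, which is the Euclidean one.
\<close>

definition dag :: "nat \<Rightarrow> (nat \<times> nat) set \<Rightarrow> bool" where
  "dag d E \<longleftrightarrow> E \<subseteq> {1..d} \<times> {1..d} \<and> acyclic E"

definition Pa :: "(nat \<times> nat) set \<Rightarrow> nat \<Rightarrow> nat set" where
  "Pa E j = {k. (k, j) \<in> E}"

datatype var_kind = Continuous | Count

definition admissible_support :: "var_kind \<Rightarrow> real set \<Rightarrow> bool" where
  "admissible_support \<kappa> S = (case \<kappa> of
     Continuous \<Rightarrow> is_interval S \<and> interior S \<noteq> {}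
   | Count \<Rightarrow> (\<exists>I :: int set. S = of_int ` I \<and> (\<forall>a\<in>I. \<forall>c\<in>I. {a..c} \<subseteq> I) \<and>
       bdd_below I \<and> (infinite I \<or> card I \<ge> 3)))"

definition supp_interior :: "var_kind \<Rightarrow> real set \<Rightarrow> real set" where
  "supp_interior \<kappa> S = (case \<kappa> of Continuous \<Rightarrow> interior S | Count \<Rightarrow> S)"

definition ref_measure :: "var_kind \<Rightarrow> real set \<Rightarrow> real measure" where
  "ref_measure \<kappa> S = (case \<kappa> of
     Continuous \<Rightarrow> density lborel (indicator S)
   | Count \<Rightarrow> distr (count_space S) borel (\<lambda>u. u))"

lemma sets_ref_measure [simp, measurable_cong]: "sets (ref_measure \<kappa> S) = sets borel"
  by (cases \<kappa>) (simp_all add: ref_measure_def)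

text \<open>
  An interval support need not be closed, so ``\<open>S j\<close> is the support of coordinate \<open>j\<close>'' means that
  \<open>S j\<close> carries the law of that coordinate and each of its nonempty relatively open subsets is charged.
\<close>

definition coordinate_law ::
  "nat \<Rightarrow> (nat \<Rightarrow> var_kind) \<Rightarrow> (nat \<Rightarrow> real set) \<Rightarrow> (nat \<Rightarrow> real) measure \<Rightarrow> bool" where
  "coordinate_law d \<kappa> S P \<longleftrightarrow>
     prob_space P \<and> sets P = sets (PiM {1..d} (\<lambda>_. borel)) \<and>
     (\<forall>j\<in>{1..d}. admissible_support (\<kappa> j) (S j) \<and>
        (AE x in P. x j \<in> S j) \<and>
        (\<forall>U. open U \<and> U \<inter> S j \<noteq> {} \<longrightarrow> measure P {x \<in> space P. x j \<in> U} > 0))"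

definition interior_box ::
  "(nat \<Rightarrow> var_kind) \<Rightarrow> (nat \<Rightarrow> real set) \<Rightarrow> nat set \<Rightarrow> (nat \<Rightarrow> real) set" where
  "interior_box \<kappa> S A = PiE A (\<lambda>i. supp_interior (\<kappa> i) (S i))"

definition C2_on :: "(real \<Rightarrow> real) \<Rightarrow> real set \<Rightarrow> bool" where
  "C2_on f U \<longleftrightarrow> (\<exists>f' f''.
     (\<forall>t\<in>U. (f has_real_derivative f' t) (at t)) \<and>
     (\<forall>t\<in>U. (f' has_real_derivative f'' t) (at t)) \<and>
     continuous_on U f'')"

text \<open>
  Joint \<open>C\<^sup>2\<close> in the coordinates \<open>K\<close>, on a set \<open>U\<close> that is open in these coordinates and on which
  all others are constant: all partial derivatives up to order two exist and are jointly continuous.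
\<close>

definition joint_C2_on :: "nat set \<Rightarrow> ((nat \<Rightarrow> real) \<Rightarrow> real) \<Rightarrow> (nat \<Rightarrow> real) set \<Rightarrow> bool" where
  "joint_C2_on K f U \<longleftrightarrow> continuous_on U f \<and> (\<exists>D1 D2.
     (\<forall>k\<in>K. continuous_on U (D1 k) \<and>
        (\<forall>x\<in>U. ((\<lambda>t. f (x(k := t))) has_real_derivative D1 k x) (at (x k)))) \<and>
     (\<forall>k\<in>K. \<forall>l\<in>K. continuous_on U (D2 k l) \<and>
        (\<forall>x\<in>U. ((\<lambda>t. D1 k (x(l := t))) has_real_derivative D2 k l x) (at (x l)))))"

text \<open>The domain of finiteness of \<open>A\<^sub>j\<close> matters below, hence the extended real values.\<close>

definition log_partition :: "real measure \<Rightarrow> (real \<Rightarrow> real) \<Rightarrow> real \<Rightarrow> ereal" where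
  "log_partition \<nu> b t =
     (let I = \<integral>\<^sup>+ u. ennreal (b u * exp (u * t)) \<partial>\<nu>
      in if I = \<infinity> then \<infinity> else ereal (ln (enn2real I)))"

text \<open>
  \<open>f\<close> are the source densities, \<open>b\<close> the base functions, and \<open>\<eta> j\<close> is a function of the
  parent values of \<open>j\<close>, a point of a product over \<open>Pa E j\<close>.
\<close>

definition node_density ::
  "(nat \<Rightarrow> var_kind) \<Rightarrow> (nat \<Rightarrow> real set) \<Rightarrow> (nat \<times> nat) set \<Rightarrow>
   (nat \<Rightarrow> real \<Rightarrow> real) \<Rightarrow> (nat \<Rightarrow> real \<Rightarrow> real) \<Rightarrow> (nat \<Rightarrow> (nat \<Rightarrow> real) \<Rightarrow> real) \<Rightarrow>
   nat \<Rightarrow> (nat \<Rightarrow> real) \<Rightarrow> real" where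
  "node_density \<kappa> S E f b \<eta> j x =
     (if Pa E j = {} then f j (x j)
      else let t = \<eta> j (restrict x (Pa E j))
           in b j (x j) * exp (x j * t - real_of_ereal
                (log_partition (ref_measure (\<kappa> j) (S j)) (b j) t)))"

text \<open>
  The factorization is required on the product-support interior only: the rest of the product support
  is a null set for the product of the reference measures.
\<close>

definition glm_factorization ::
  "nat \<Rightarrow> (nat \<Rightarrow> var_kind) \<Rightarrow> (nat \<Rightarrow> real set) \<Rightarrow> (nat \<Rightarrow> real) measure \<Rightarrow> (nat \<times> nat) set \<Rightarrow>
   (nat \<Rightarrow> real \<Rightarrow> real) \<Rightarrow> (nat \<Rightarrow> real \<Rightarrow> real) \<Rightarrow> (nat \<Rightarrow> (nat \<Rightarrow> real) \<Rightarrow> real) \<Rightarrow> bool" where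
  "glm_factorization d \<kappa> S P E f b \<eta> \<longleftrightarrow>
     (let \<nu> = PiM {1..d} (\<lambda>j. ref_measure (\<kappa> j) (S j)) in
      \<exists>p \<in> borel_measurable \<nu>. P = density \<nu> (\<lambda>x. ennreal (p x)) \<and>
        (\<forall>x \<in> interior_box \<kappa> S {1..d}. 0 < p x \<and>
           p x = (\<Prod>j\<in>{1..d}. node_density \<kappa> S E f b \<eta> j x)))"

definition regular_source :: "var_kind \<Rightarrow> real set \<Rightarrow> (real \<Rightarrow> real) \<Rightarrow> bool" where
  "regular_source \<kappa> S f \<longleftrightarrow>
     (\<integral>\<^sup>+ u. ennreal (f u) \<partial>ref_measure \<kappa> S) = 1 \<and>
     (\<forall>u \<in> supp_interior \<kappa> S. 0 < f u) \<and>
     (\<kappa> = Continuous \<longrightarrow> C2_on (\<lambda>u. ln (f u)) (interior S))"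

definition regular_base :: "var_kind \<Rightarrow> real set \<Rightarrow> (real \<Rightarrow> real) \<Rightarrow> bool" where
  "regular_base \<kappa> S b \<longleftrightarrow>
     (\<forall>u \<in> supp_interior \<kappa> S. 0 < b u) \<and>
     (\<kappa> = Continuous \<longrightarrow> C2_on (\<lambda>u. ln (b u)) (interior S))"

definition regular_natural_parameter ::
  "(nat \<Rightarrow> var_kind) \<Rightarrow> (nat \<Rightarrow> real set) \<Rightarrow> nat set \<Rightarrow> ((nat \<Rightarrow> real) \<Rightarrow> real) \<Rightarrow>
   (real \<Rightarrow> ereal) \<Rightarrow> bool" where
  "regular_natural_parameter \<kappa> S A h L \<longleftrightarrow>
     (\<forall>z \<in> interior_box \<kappa> S {k \<in> A. \<kappa> k = Count}.
        joint_C2_on {k \<in> A. \<kappa> k = Continuous} h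
          {x \<in> interior_box \<kappa> S A. \<forall>k\<in>A. \<kappa> k = Count \<longrightarrow> x k = z k}) \<and>
     h ` interior_box \<kappa> S A \<subseteq> interior {t. L t < \<infinity>}"

definition semiparametric_glm_dag ::
  "nat \<Rightarrow> (nat \<Rightarrow> var_kind) \<Rightarrow> (nat \<Rightarrow> real set) \<Rightarrow> (nat \<Rightarrow> real) measure \<Rightarrow> (nat \<times> nat) set \<Rightarrow>
   (nat \<Rightarrow> real \<Rightarrow> real) \<Rightarrow> (nat \<Rightarrow> real \<Rightarrow> real) \<Rightarrow> (nat \<Rightarrow> (nat \<Rightarrow> real) \<Rightarrow> real) \<Rightarrow> bool" where
  "semiparametric_glm_dag d \<kappa> S P E f b \<eta> \<longleftrightarrow>
     glm_factorization d \<kappa> S P E f b \<eta> \<and>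
     (\<forall>j\<in>{1..d}. if Pa E j = {} then regular_source (\<kappa> j) (S j) (f j)
        else regular_base (\<kappa> j) (S j) (b j) \<and>
          regular_natural_parameter \<kappa> S (Pa E j) (\<eta> j)
            (log_partition (ref_measure (\<kappa> j) (S j)) (b j)) \<and>
          (\<forall>k \<in> Pa E j. \<exists>x \<in> interior_box \<kappa> S (Pa E j). \<exists>t \<in> supp_interior (\<kappa> k) (S k).
             \<eta> j (x(k := t)) \<noteq> \<eta> j x))"

definition nonlinear_links ::
  "(nat \<Rightarrow> var_kind) \<Rightarrow> (nat \<Rightarrow> real set) \<Rightarrow> (nat \<times> nat) set \<Rightarrow>
   (nat \<Rightarrow> (nat \<Rightarrow> real) \<Rightarrow> real) \<Rightarrow> bool" where
  "nonlinear_links \<kappa> S E \<eta> \<longleftrightarrow>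
     (\<forall>(k, i) \<in> E. \<exists>z \<in> interior_box \<kappa> S (Pa E i - {k}).
        \<not> (\<exists>a c. \<forall>t \<in> supp_interior (\<kappa> k) (S k). \<eta> i (z(k := t)) = a * t + c))"

definition follows_nonlinear_glm_dag ::
  "nat \<Rightarrow> (nat \<Rightarrow> var_kind) \<Rightarrow> (nat \<Rightarrow> real set) \<Rightarrow> (nat \<Rightarrow> real) measure \<Rightarrow> (nat \<times> nat) set \<Rightarrow> bool"
  where
  "follows_nonlinear_glm_dag d \<kappa> S P E \<longleftrightarrow>
     (\<exists>f b \<eta>. semiparametric_glm_dag d \<kappa> S P E f b \<eta> \<and> nonlinear_links \<kappa> S E \<eta>)"

end

theory Submission
  imports Defs
begin

text \<open>
  Both factorizations give continuous densities on the support interior, so they agree there pointwise.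
  Work with mixed second differences of the log density. If \<open>j\<close> is a sink, every mixed difference in
  \<open>j\<close> and \<open>k\<close> is linear in the increment of \<open>x j\<close>. If \<open>j\<close> is not a sink, let \<open>i\<close> be its last child;
  no node has both as parents, so the mixed difference in \<open>i\<close> and \<open>j\<close> is the increment of \<open>x i\<close>
  times the increment of \<open>\<eta> i\<close> in \<open>x j\<close>, which is not linear in \<open>x j\<close> by nonlinearity. Hence both
  graphs have the same sinks. The parents of a sink \<open>j\<close> are the \<open>k\<close> for which these mixed differences
  do not all vanish, so they agree too. Integrating out the sink leaves the product of the other
  factors on both sides, and one repeats the argument.
\<close>

subsection \<open>Sinks and mixed differences\<close>

text \<open>A finite difference takes the place of a mixed partial derivative, so that continuous
  and count coordinates are handled alike. For \<open>i \<noteq> j\<close> it annihilates every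
  summand that is independent of \<open>x i\<close> or of \<open>x j\<close>.\<close>

definition mixed_diff ::
  "((nat \<Rightarrow> real) \<Rightarrow> real) \<Rightarrow> (nat \<Rightarrow> real) \<Rightarrow> nat \<Rightarrow> real \<Rightarrow> real \<Rightarrow> nat \<Rightarrow> real \<Rightarrow> real \<Rightarrow> real" where
  "mixed_diff F x i u v j s t =
     F (x(i := u, j := s)) - F (x(i := v, j := s)) - F (x(i := u, j := t)) + F (x(i := v, j := t))"

lemma mixed_diff_commute:
  "i \<noteq> j \<Longrightarrow> mixed_diff F x i u v j s t = mixed_diff F x j s t i u v"
  by (simp add: mixed_diff_def fun_upd_twist)

lemma mixed_diff_sum:
  "mixed_diff (\<lambda>x. \<Sum>m\<in>W. F m x) x i u v j s t = (\<Sum>m\<in>W. mixed_diff (F m) x i u v j s t)"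
  by (simp add: mixed_diff_def sum.distrib sum_subtractf)

lemma mixed_diff_cong:
  assumes "\<And>y. y \<in> PiE V I \<Longrightarrow> F y = F' y" and "x \<in> PiE V I" "i \<in> V" "j \<in> V"
    and "u \<in> I i" "v \<in> I i" "s \<in> I j" "t \<in> I j"
  shows "mixed_diff F x i u v j s t = mixed_diff F' x i u v j s t"
proof -
  have "x(i := u', j := s') \<in> PiE V I" if "u' \<in> I i" "s' \<in> I j" for u' s'
    using assms(2-4) that by (auto simp: PiE_iff extensional_def)
  then show ?thesis
    using assms by (simp add: mixed_diff_def)
qed

text \<open>The logarithm of a GLM factorization, stripped of measure theory: \<open>a\<close>
  stands for the log base functions, \<open>e\<close> for the natural parameters, \<open>B\<close>
  for the cumulants. Both \<open>e\<close> and \<open>B\<close> take whole points, and the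
  congruence assumptions carry the dependence on parents alone.\<close>

locale log_factors =
  fixes V :: "nat set" and I :: "nat \<Rightarrow> real set" and E :: "(nat \<times> nat) set"
    and a :: "nat \<Rightarrow> real \<Rightarrow> real" and e B :: "nat \<Rightarrow> (nat \<Rightarrow> real) \<Rightarrow> real"
  assumes finite_V: "finite V"
    and edges: "E \<subseteq> V \<times> V"
    and acyclic_E: "acyclic E"
    and two_points: "\<And>j. j \<in> V \<Longrightarrow> \<exists>u\<in>I j. \<exists>v\<in>I j. u \<noteq> v"
    and e_cong: "\<And>j x y. (\<And>k. k \<in> Pa E j \<Longrightarrow> x k = y k) \<Longrightarrow> e j x = e j y"
    and B_cong: "\<And>j x y. (\<And>k. k \<in> Pa E j \<Longrightarrow> x k = y k) \<Longrightarrow> B j x = B j y"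
    and not_affine: "\<And>k i. (k, i) \<in> E \<Longrightarrow>
      \<exists>x\<in>PiE V I. \<not> (\<exists>\<alpha> c. \<forall>t\<in>I k. e i (x(k := t)) = \<alpha> * t + c)"
begin

definition q :: "nat \<Rightarrow> (nat \<Rightarrow> real) \<Rightarrow> real" where
  "q j x = a j (x j) + x j * e j x - B j x"

text \<open>Relative to \<open>W\<close>, because vertices are peeled off one at a time while
  \<open>V\<close>, \<open>E\<close> and the space of points stay fixed.\<close>

definition sink_in :: "nat set \<Rightarrow> nat \<Rightarrow> bool" where
  "sink_in W j \<longleftrightarrow> j \<in> W \<and> (\<forall>m\<in>W. (j, m) \<notin> E)"

lemma no_loop: "(i, i) \<notin> E"
  using acyclic_E by (auto simp: acyclic_def)

lemma e_upd: "k \<notin> Pa E j \<Longrightarrow> e j (x(k := t)) = e j x"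
  by (rule e_cong) auto

lemma B_upd: "k \<notin> Pa E j \<Longrightarrow> B j (x(k := t)) = B j x"
  by (rule B_cong) auto

lemma q_upd: "k \<notin> Pa E j \<Longrightarrow> k \<noteq> j \<Longrightarrow> q j (x(k := t)) = q j x"
  by (simp add: q_def e_upd B_upd)

text \<open>A factor \<open>q m\<close> with \<open>m \<noteq> i\<close> is free of
  \<open>x i\<close> unless \<open>m\<close> is a child of \<open>i\<close>, and by
  \<open>sep\<close> a child is free of \<open>x j\<close>. Only \<open>q i\<close> survives. There
  \<open>a i\<close> is free of \<open>x j\<close> and \<open>B i\<close> is free of
  \<open>x i\<close>, which leaves the product \<open>x i * e i x\<close>.\<close>

lemma mixed_diff_sum_q:
  assumes W: "finite W" "i \<in> W" "i \<noteq> j"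
    and sep: "\<And>m. m \<in> W \<Longrightarrow> m \<noteq> i \<Longrightarrow> (i, m) \<in> E \<Longrightarrow> m \<noteq> j \<and> (j, m) \<notin> E"
  shows "mixed_diff (\<lambda>x. \<Sum>m\<in>W. q m x) x i u v j s t =
    (u - v) * (e i (x(j := s)) - e i (x(j := t)))"
proof -
  have "mixed_diff (q m) x i u v j s t = 0" if "m \<in> W" "m \<noteq> i" for m
  proof (cases "(i, m) \<in> E")
    case True
    then have "m \<noteq> j" "j \<notin> Pa E m"
      using sep that by (auto simp: Pa_def)
    then show ?thesis
      by (simp add: mixed_diff_def q_upd)
  next
    case False
    then have "i \<notin> Pa E m" by (simp add: Pa_def)
    then show ?thesis
      using \<open>m \<noteq> i\<close> \<open>i \<noteq> j\<close> by (simp add: mixed_diff_def q_upd fun_upd_twist[OF \<open>i \<noteq> j\<close>])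
  qed
  then have "mixed_diff (\<lambda>x. \<Sum>m\<in>W. q m x) x i u v j s t = mixed_diff (q i) x i u v j s t"
    unfolding mixed_diff_sum using W by (subst sum.remove[of W i]) auto
  also have "i \<notin> Pa E i"
    using no_loop by (simp add: Pa_def)
  then have "mixed_diff (q i) x i u v j s t = (u - v) * (e i (x(j := s)) - e i (x(j := t)))"
    using \<open>i \<noteq> j\<close>
    by (simp add: mixed_diff_def q_def e_upd B_upd fun_upd_twist[OF \<open>i \<noteq> j\<close>] algebra_simps)
  finally show ?thesis .
qed

lemma mixed_diff_sink:
  assumes "finite W" "sink_in W j" "k \<noteq> j"
  shows "mixed_diff (\<lambda>x. \<Sum>m\<in>W. q m x) x j u v k s t =
    (u - v) * (e j (x(k := s)) - e j (x(k := t)))"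
  using assms by (intro mixed_diff_sum_q) (auto simp: sink_in_def)

text \<open>The converse of a finite acyclic relation is well-founded; a minimal element for it is a
  last one.\<close>

lemma last_element:
  assumes "C \<subseteq> V" "C \<noteq> {}"
  obtains i where "i \<in> C" "\<And>m. m \<in> C \<Longrightarrow> (i, m) \<notin> E"
proof -
  have "finite E"
    using finite_V edges finite_subset by blast
  then have "wf (E\<inverse>)"
    using acyclic_E by (rule finite_acyclic_wf_converse)
  then show thesis
    using assms that by (metis wf_eq_minimal converse_iff ex_in_conv)
qed

end

section \<open>Comparing two factorizations of the same function\<close>

lemma affine_if_proportional_differences:
  fixes h :: "real \<Rightarrow> real"
  assumes "w \<noteq> 0" and "\<And>s. s \<in> J \<Longrightarrow> w * (h s - h t) = (s - t) * c"
  shows "\<exists>\<alpha> c. \<forall>s\<in>J. h s = \<alpha> * s + c"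
proof (intro exI ballI)
  fix s assume "s \<in> J"
  then show "h s = (c / w) * s + (h t - (c / w) * t)"
    using assms by (simp add: field_simps)
qed

locale two_log_factors =
  L: log_factors V I E a e B + R: log_factors V I E' a' e' B'
  for V I E a e B E' a' e' B'
begin

lemma sink_transfer:
  assumes W: "W \<subseteq> V" and sink: "L.sink_in W j"
    and eq: "\<And>x. x \<in> PiE V I \<Longrightarrow> (\<Sum>m\<in>W. L.q m x) = (\<Sum>m\<in>W. R.q m x)"
  shows "R.sink_in W j"
proof (rule ccontr)
  assume "\<not> R.sink_in W j"
  then have "{m\<in>W. (j, m) \<in> E'} \<noteq> {}"
    using sink by (auto simp: R.sink_in_def L.sink_in_def)
  moreover have "{m\<in>W. (j, m) \<in> E'} \<subseteq> V"
    using W by auto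
  \<comment> \<open>Since \<open>i\<close> is a last child of \<open>j\<close> in \<open>W\<close>,
    no child of \<open>j\<close> in \<open>W\<close> is also a child of \<open>i\<close>. This is
    the main part of the separation hypothesis of \<open>mixed_diff_sum_q\<close>.\<close>
  ultimately obtain i where i: "i \<in> W" "(j, i) \<in> E'"
      and last: "\<And>m. m \<in> W \<Longrightarrow> (j, m) \<in> E' \<Longrightarrow> (i, m) \<notin> E'"
    by (elim R.last_element) auto
  have fin: "finite W"
    using W L.finite_V finite_subset by blast
  \<comment> \<open>An edge from \<open>i\<close> back to \<open>j\<close> would close a cycle. Its
    absence is the remaining part of the separation hypothesis, that \<open>j\<close> itself is not
    a child of \<open>i\<close>.\<close>
  have ij: "i \<noteq> j" "(i, j) \<notin> E'"
    using i R.no_loop R.acyclic_E by (auto simp: acyclic_def dest: trancl_into_trancl2)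
  have V: "i \<in> V" "j \<in> V"
    using i R.edges by auto
  obtain x where x: "x \<in> PiE V I"
      and na: "\<not> (\<exists>\<alpha> c. \<forall>t\<in>I j. e' i (x(j := t)) = \<alpha> * t + c)"
    using R.not_affine[OF i(2)] by auto
  obtain u v where uv: "u \<in> I i" "v \<in> I i" "u \<noteq> v"
    using R.two_points V by blast
  \<comment> \<open>The reference value in coordinate \<open>j\<close> is \<open>x j\<close>, which
    lies in \<open>I j\<close> because \<open>x\<close> is in the box. The right-hand side is linear
    in \<open>s - x j\<close>, so \<open>e' i\<close> would be affine in \<open>x j\<close>.\<close>
  have "(u - v) * (e' i (x(j := s)) - e' i (x(j := x j))) =
      (s - x j) * (e j (x(i := u)) - e j (x(i := v)))" if "s \<in> I j" for s
  proof -
    have "(u - v) * (e' i (x(j := s)) - e' i (x(j := x j))) =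
        mixed_diff (\<lambda>x. \<Sum>m\<in>W. R.q m x) x i u v j s (x j)"
      using fin i(1) ij last by (intro R.mixed_diff_sum_q[symmetric]) auto
    also have "\<dots> = mixed_diff (\<lambda>x. \<Sum>m\<in>W. L.q m x) x i u v j s (x j)"
      using x V uv that by (intro mixed_diff_cong[where V = V and I = I]) (auto simp: eq)
    also have "\<dots> = mixed_diff (\<lambda>x. \<Sum>m\<in>W. L.q m x) x j s (x j) i u v"
      using ij by (simp add: mixed_diff_commute)
    also have "\<dots> = (s - x j) * (e j (x(i := u)) - e j (x(i := v)))"
      using fin sink ij(1) by (rule L.mixed_diff_sink)
    finally show ?thesis .
  qed
  then have "\<exists>\<alpha> c. \<forall>s\<in>I j. e' i (x(j := s)) = \<alpha> * s + c"
    using uv(3) by (intro affine_if_proportional_differences[of "u - v" _ _ "x j"]) auto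
  with na show False by blast
qed

text \<open>If \<open>k\<close> were a parent on the left only, the mixed difference in
  \<open>j\<close> and \<open>k\<close> would vanish on the right. Then \<open>e j\<close> would be
  constant in \<open>x k\<close>, hence affine, against nonlinearity.\<close>

lemma sink_parents_subset:
  assumes W: "W \<subseteq> V" and sink: "L.sink_in W j" "R.sink_in W j"
    and eq: "\<And>x. x \<in> PiE V I \<Longrightarrow> (\<Sum>m\<in>W. L.q m x) = (\<Sum>m\<in>W. R.q m x)"
  shows "Pa E j \<subseteq> Pa E' j"
proof (rule subsetI, rule ccontr)
  fix k assume k: "k \<in> Pa E j" "k \<notin> Pa E' j"
  have kj: "k \<noteq> j" "k \<in> V" "j \<in> V"
    using k L.no_loop L.edges by (auto simp: Pa_def)
  have fin: "finite W"
    using W L.finite_V finite_subset by blast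
  obtain x where x: "x \<in> PiE V I"
      and na: "\<not> (\<exists>\<alpha> c. \<forall>t\<in>I k. e j (x(k := t)) = \<alpha> * t + c)"
    using L.not_affine[of k j] k by (auto simp: Pa_def)
  obtain u v where uv: "u \<in> I j" "v \<in> I j" "u \<noteq> v"
    using R.two_points kj by blast
  \<comment> \<open>The zero is written as a multiple of \<open>s - x k\<close> to match
    \<open>affine_if_proportional_differences\<close> with slope zero.\<close>
  have "(u - v) * (e j (x(k := s)) - e j (x(k := x k))) = (s - x k) * 0" if "s \<in> I k" for s
  proof -
    have "(u - v) * (e j (x(k := s)) - e j (x(k := x k))) =
        mixed_diff (\<lambda>x. \<Sum>m\<in>W. L.q m x) x j u v k s (x k)"
      using L.mixed_diff_sink[OF fin sink(1) kj(1)] by simp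
    also have "\<dots> = mixed_diff (\<lambda>x. \<Sum>m\<in>W. R.q m x) x j u v k s (x k)"
      using x kj uv that by (intro mixed_diff_cong[where V = V and I = I]) (auto simp: eq)
    also have "\<dots> = 0"
      using R.mixed_diff_sink[OF fin sink(2) kj(1)] R.e_upd[OF k(2)] by simp
    finally show ?thesis by simp
  qed
  then have "\<exists>\<alpha> c. \<forall>s\<in>I k. e j (x(k := s)) = \<alpha> * s + c"
    using uv(3) by (intro affine_if_proportional_differences[of "u - v" _ _ "x k"]) auto
  with na show False by blast
qed

end

context two_log_factors
begin

interpretation swap: two_log_factors V I E' a' e' B' E a e B
  by unfold_locales

text \<open>
  The hypothesis \<open>normalized\<close> stands for the fact that both factors at \<open>j\<close> integrate to one over \<open>x j\<close>.
\<close>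

lemma parents_eq:
  assumes normalized: "\<And>j x c. j \<in> V \<Longrightarrow> x \<in> PiE V I \<Longrightarrow>
      (\<And>u. u \<in> I j \<Longrightarrow> L.q j (x(j := u)) = R.q j (x(j := u)) + c) \<Longrightarrow> c = 0"
    and "W \<subseteq> V"
    and "\<And>x. x \<in> PiE V I \<Longrightarrow> (\<Sum>m\<in>W. L.q m x) = (\<Sum>m\<in>W. R.q m x)"
  shows "\<forall>j\<in>W. Pa E j = Pa E' j"
  using assms(2,3)
proof (induction "card W" arbitrary: W)
  case 0
  then show ?case
    using L.finite_V finite_subset by fastforce
next
  case (Suc n)
  note W = \<open>W \<subseteq> V\<close> and eq = Suc.prems(2)
  have fin: "finite W"
    using W L.finite_V finite_subset by blast
  have "W \<noteq> {}"
    using Suc.hyps(2) by auto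
  then obtain j where sink: "L.sink_in W j"
    using L.last_element[OF W] unfolding L.sink_in_def by metis
  have sink': "R.sink_in W j"
    using W sink eq by (rule sink_transfer)
  have jW: "j \<in> W"
    using sink by (simp add: L.sink_in_def)
  have parents: "Pa E j = Pa E' j"
    using sink_parents_subset[OF W sink sink' eq] swap.sink_parents_subset[OF W sink' sink]
    by (simp add: eq)
  \<comment> \<open>As \<open>j\<close> is a sink of \<open>W\<close> for both graphs, the two
    remaining sums are free of \<open>x j\<close>. Along \<open>x j\<close> the factors at
    \<open>j\<close> therefore differ by a constant, which \<open>normalized\<close> forces to be
    zero.\<close>
  have "(\<Sum>m\<in>W - {j}. L.q m x) = (\<Sum>m\<in>W - {j}. R.q m x)" if x: "x \<in> PiE V I" for x
  proof -
    have "(\<Sum>m\<in>W - {j}. R.q m x) - (\<Sum>m\<in>W - {j}. L.q m x) = 0"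
    proof (rule normalized)
      show "j \<in> V" "x \<in> PiE V I"
        using jW W x by auto
      fix u assume u: "u \<in> I j"
      have "(\<Sum>m\<in>W - {j}. L.q m (x(j := u))) = (\<Sum>m\<in>W - {j}. L.q m x)"
        using sink by (intro sum.cong) (auto simp: L.sink_in_def Pa_def intro!: L.q_upd)
      moreover have "(\<Sum>m\<in>W - {j}. R.q m (x(j := u))) = (\<Sum>m\<in>W - {j}. R.q m x)"
        using sink' by (intro sum.cong) (auto simp: R.sink_in_def Pa_def intro!: R.q_upd)
      moreover have "x(j := u) \<in> PiE V I"
        using x u jW W by (auto simp: PiE_iff extensional_def)
      note eq[OF this]
      ultimately show "L.q j (x(j := u)) = R.q j (x(j := u)) +
          ((\<Sum>m\<in>W - {j}. R.q m x) - (\<Sum>m\<in>W - {j}. L.q m x))"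
        using fin jW by (simp add: sum.remove)
    qed
    then show ?thesis by simp
  qed
  then have "\<forall>i\<in>W - {j}. Pa E i = Pa E' i"
    using Suc.hyps(2) W fin jW by (intro Suc.hyps(1)) auto
  with parents show ?case by blast
qed

end

subsection \<open>Supports and reference measures\<close>

lemma count_support_Ints:
  "admissible_support Count S \<Longrightarrow> S \<subseteq> \<int>"
  by (auto simp: admissible_support_def)

lemma countable_count_support:
  "admissible_support Count S \<Longrightarrow> countable S"
  by (auto simp: admissible_support_def)

text \<open>Distinct integers are at distance at least 1, so the set is discrete. Continuity is thus
  automatic in count coordinates.\<close>

lemma continuous_on_Ints:
  fixes f :: "real \<Rightarrow> 'a::topological_space"
  assumes "S \<subseteq> \<int>"
  shows "continuous_on S f"
proof -
  have "uniform_discrete (\<int> :: real set)"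
    unfolding uniform_discrete_def
    by (rule exI[of _ 1]) (simp, metis Ints_eq_abs_less1 dist_real_def)
  then have "uniform_discrete S"
    using assms uniform_discrete_subset by blast
  then show ?thesis
    by (rule continuous_on_discrete[OF uniform_discrete_imp_discrete])
qed

lemma admissible_support_borel:
  assumes "admissible_support \<kappa> S"
  shows "S \<in> sets borel"
proof (cases \<kappa>)
  case Continuous
  then show ?thesis
    using assms by (simp add: admissible_support_def real_interval_borel_measurable)
next
  case Count
  then have "countable S"
    using assms countable_count_support by simp
  then show ?thesis
    by (rule sets.countable[rotated]) simp
qed

lemma supp_interior_borel:
  "admissible_support \<kappa> S \<Longrightarrow> supp_interior \<kappa> S \<in> sets borel"
  using admissible_support_borel by (cases \<kappa>) (auto simp: supp_interior_def)

lemma supp_interior_two_points: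
  assumes "admissible_support \<kappa> S"
  shows "\<exists>u\<in>supp_interior \<kappa> S. \<exists>v\<in>supp_interior \<kappa> S. u \<noteq> v"
proof (rule ccontr)
  assume contra: "\<not> ?thesis"
  then have sub: "\<exists>x. supp_interior \<kappa> S \<subseteq> {x}"
    by blast
  show False
  proof (cases \<kappa>)
    case Continuous
    have "interior S \<noteq> {x}" for x
      by (metis open_interior not_open_singleton)
    then show False
      using sub assms Continuous
      by (auto simp: supp_interior_def admissible_support_def subset_singleton_iff)
  next
    case Count
    then obtain I :: "int set" where "S = of_int ` I" "infinite I \<or> card I \<ge> 3"
      using assms by (auto simp: admissible_support_def)
    moreover have "finite S \<and> card S \<le> 1"
      using sub Count by (auto simp: supp_interior_def subset_singleton_iff)
    moreover have "inj_on (of_int :: int \<Rightarrow> real) I"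
      by (simp add: inj_on_def)
    ultimately show False
      by (simp add: card_image finite_image_iff)
  qed
qed

text \<open>The frontier of a convex set is a Lebesgue null set; in the count case the interior is
  the whole support.\<close>

lemma AE_ref_measure_supp_interior:
  assumes "admissible_support \<kappa> S"
  shows "AE u in ref_measure \<kappa> S. u \<in> supp_interior \<kappa> S"
proof (cases \<kappa>)
  case Continuous
  have [measurable]: "S \<in> sets borel"
    using assms by (rule admissible_support_borel)
  have "convex S"
    using assms Continuous by (simp add: admissible_support_def is_interval_convex)
  then have "frontier S \<in> null_sets lborel"
    using negligible_convex_frontier[of S]
    by (simp add: negligible_iff_null_sets null_sets_completion_iff)
  then have "AE u in lborel. u \<notin> frontier S"
    by (rule AE_not_in)
  then have "AE u in lborel. u \<in> S \<longrightarrow> u \<in> interior S"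
    by eventually_elim (use closure_subset in \<open>auto simp: frontier_def\<close>)
  then have "AE u in density lborel (indicator S). u \<in> interior S"
    by (subst AE_density) (auto elim!: eventually_mono split: split_indicator_asm)
  then show ?thesis
    unfolding ref_measure_def supp_interior_def Continuous var_kind.case .
next
  case Count
  show ?thesis
    unfolding ref_measure_def supp_interior_def Count var_kind.case
    using admissible_support_borel[OF assms] by (subst AE_distr_iff) (auto simp: AE_count_space)
qed

lemma sigma_finite_ref_measure:
  assumes "admissible_support \<kappa> S"
  shows "sigma_finite_measure (ref_measure \<kappa> S)"
proof (cases \<kappa>)
  case Continuous
  have [measurable]: "S \<in> sets borel"
    using assms by (rule admissible_support_borel)
  show ?thesis
    unfolding ref_measure_def Continuous var_kind.case
    by (subst sigma_finite_measure.sigma_finite_iff_density_finite[OF lborel.sigma_finite_measure_axioms])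
      (auto simp: indicator_def)
next
  case Count
  have [measurable]: "S \<in> sets borel"
    using assms by (rule admissible_support_borel)
  have S: "S \<subseteq> \<int>"
    using assms Count count_support_Ints by blast
  \<comment> \<open>The measure lives on the whole real line, so the countable cover consists of the
    singletons of \<open>S\<close>, each of finite measure, and the null set
    \<open>- S\<close>.\<close>
  have "finite ((\<lambda>u. u) -` {a} \<inter> S)" "(\<lambda>u. u) -` (- S) \<inter> S = {}" for a
    by (auto intro: finite_subset[of _ "{a}"])
  moreover have "countable S"
    using assms Count countable_count_support by simp
  ultimately show ?thesis
    unfolding ref_measure_def Count var_kind.case
    by unfold_locales
      (auto intro!: exI[of _ "insert (- S) ((\<lambda>a. {a}) ` S)"]
        simp: emeasure_distr emeasure_count_space)
qed

text \<open>This positivity is what upgrades almost everywhere equality of continuous densities to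
  pointwise equality.\<close>

lemma emeasure_ref_measure_open_pos:
  assumes adm: "admissible_support \<kappa> S" and U: "open U" "U \<inter> supp_interior \<kappa> S \<noteq> {}"
  shows "emeasure (ref_measure \<kappa> S) (U \<inter> supp_interior \<kappa> S) > 0"
proof (cases \<kappa>)
  case Continuous
  have [measurable]: "S \<in> sets borel" "U \<in> sets borel"
    using adm U(1) by (simp_all add: admissible_support_borel)
  have *: "open (U \<inter> interior S)" "U \<inter> interior S \<noteq> {}"
    using U Continuous by (auto simp: supp_interior_def)
  then have "U \<inter> interior S \<notin> null_sets lborel"
    using open_not_negligible[OF *] by (simp add: negligible_iff_null_sets null_sets_completion_iff)
  then have "emeasure lborel (U \<inter> interior S) > 0"
    using * by (auto simp: null_sets_def zero_less_iff_neq_zero)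
  also have "(\<integral>\<^sup>+ u. indicator S u * indicator (U \<inter> interior S) u \<partial>lborel) =
      (\<integral>\<^sup>+ u. indicator (U \<inter> interior S) u \<partial>lborel)"
    using interior_subset by (intro nn_integral_cong) (auto simp: indicator_def)
  then have "emeasure lborel (U \<inter> interior S) = emeasure (ref_measure \<kappa> S) (U \<inter> supp_interior \<kappa> S)"
    using Continuous * by (simp add: ref_measure_def supp_interior_def emeasure_density)
  finally show ?thesis .
next
  case Count
  have [measurable]: "S \<in> sets borel" "U \<in> sets borel"
    using adm U(1) by (simp_all add: admissible_support_borel)
  have "emeasure (count_space S) (U \<inter> S) \<noteq> 0"
    using U Count by (auto simp: supp_interior_def emeasure_count_space_eq_0)
  moreover have "(\<lambda>u. u) -` (U \<inter> S) \<inter> S = U \<inter> S"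
    by auto
  ultimately show ?thesis
    using Count
    by (simp add: ref_measure_def supp_interior_def emeasure_distr zero_less_iff_neq_zero)
qed

text \<open>By positivity \<open>g\<close> is the exponential of its logarithm. The form serves
  source densities and base functions at once.\<close>

lemma continuous_on_if_ln_C2:
  assumes adm: "admissible_support \<kappa> S" and pos: "\<forall>u\<in>supp_interior \<kappa> S. 0 < (g u :: real)"
    and C2: "\<kappa> = Continuous \<longrightarrow> C2_on (\<lambda>u. ln (g u)) (interior S)"
  shows "continuous_on (supp_interior \<kappa> S) g"
proof (cases \<kappa>)
  case Continuous
  then obtain g' where "\<forall>t\<in>interior S. ((\<lambda>u. ln (g u)) has_real_derivative g' t) (at t)"
    using C2 by (auto simp: C2_on_def)
  then have "continuous_on (interior S) (\<lambda>u. ln (g u))"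
    by (meson DERIV_isCont continuous_at_imp_continuous_on)
  then have "continuous_on (interior S) (\<lambda>u. exp (ln (g u)))"
    by (rule continuous_on_exp)
  moreover have "exp (ln (g u)) = g u" if "u \<in> interior S" for u
    using pos Continuous that by (simp add: supp_interior_def)
  ultimately have "continuous_on (interior S) g"
    by (rule continuous_on_eq)
  then show ?thesis
    using Continuous by (simp add: supp_interior_def)
next
  case Count
  then show ?thesis
    using adm count_support_Ints by (auto simp: supp_interior_def intro: continuous_on_Ints)
qed

text \<open>Regularity gives continuity on each slice with fixed count parents. Integers are
  isolated, so a slice is relatively open in the box, and continuity at a point of the slice is
  continuity within the whole box.\<close>

lemma regular_natural_parameter_continuous:
  assumes adm: "\<And>k. k \<in> A \<Longrightarrow> admissible_support (\<kappa> k) (S k)" and fin: "finite A"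
    and reg: "regular_natural_parameter \<kappa> S A h L"
  shows "continuous_on (interior_box \<kappa> S A) h"
  unfolding continuous_on_eq_continuous_within
proof
  let ?C = "{k \<in> A. \<kappa> k = Count}" and ?X = "interior_box \<kappa> S A"
  fix x assume x: "x \<in> ?X"
  define Y where "Y = {y \<in> ?X. \<forall>k\<in>A. \<kappa> k = Count \<longrightarrow> y k = x k}"
  \<comment> \<open>Radius 1 isolates the integer \<open>x k\<close>; finitely many such conditions
    cut out an open set.\<close>
  define T where "T = {y :: nat \<Rightarrow> real. \<forall>k\<in>?C. y k \<in> ball (x k) 1}"
  have T: "open T"
  proof -
    have "T = (\<Inter>k\<in>?C. (\<lambda>y. y k) -` ball (x k) 1)"
      by (auto simp: T_def)
    moreover have "open ((\<lambda>y :: nat \<Rightarrow> real. y k) -` ball (x k) 1)" for k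
      by (intro open_vimage) auto
    ultimately show ?thesis
      using fin by (auto intro: open_INT)
  qed
  have YT: "?X \<inter> T = Y"
  proof -
    have "y k = x k" if "y \<in> ?X" "y \<in> T" "k \<in> ?C" for y k
    proof -
      have k: "k \<in> A" "\<kappa> k = Count"
        using that(3) by auto
      have "S k \<subseteq> \<int>"
        using adm[OF k(1)] unfolding k(2) by (rule count_support_Ints)
      moreover have "y k \<in> S k" "x k \<in> S k"
        using PiE_mem[OF that(1)[unfolded interior_box_def] k(1)]
          PiE_mem[OF x[unfolded interior_box_def] k(1)]
        by (simp_all add: supp_interior_def k)
      ultimately have "y k \<in> \<int>" "x k \<in> \<int>"
        by auto
      moreover have "\<bar>y k - x k\<bar> < 1"
        using that(2,3) by (auto simp: T_def dist_real_def abs_minus_commute)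
      ultimately show ?thesis
        using Ints_eq_abs_less1 by blast
    qed
    then show ?thesis
      by (auto simp: Y_def T_def)
  qed
  have "restrict x ?C \<in> interior_box \<kappa> S ?C"
    using x by (auto simp: interior_box_def PiE_iff)
  moreover have "{y \<in> ?X. \<forall>k\<in>A. \<kappa> k = Count \<longrightarrow> y k = restrict x ?C k} = Y"
    by (auto simp: Y_def)
  ultimately have "continuous_on Y h"
    using reg by (auto simp: regular_natural_parameter_def joint_C2_on_def dest!: bspec)
  then have "continuous (at x within Y) h"
    using x by (auto simp: continuous_on_eq_continuous_within Y_def)
  moreover have "at x within ?X = at x within Y"
    using T YT by (intro at_within_nhd[of _ T]) (auto simp: T_def)
  ultimately show "continuous (at x within ?X) h"
    by simp
qed

lemma borel_measurable_indicator_continuous: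
  assumes "admissible_support \<kappa> S" "continuous_on (supp_interior \<kappa> S) g"
  shows "(\<lambda>u. indicator (supp_interior \<kappa> S) u * (g u :: real)) \<in> borel_measurable borel"
  using borel_measurable_continuous_on_indicator[OF supp_interior_borel assms(2)] assms(1) by simp

section \<open>The exponential family generated by a base function\<close>

locale base_density =
  fixes \<kappa> :: var_kind and S :: "real set" and b :: "real \<Rightarrow> real"
  assumes adm: "admissible_support \<kappa> S"
    and b_pos: "\<And>u. u \<in> supp_interior \<kappa> S \<Longrightarrow> 0 < b u"
    and b_cont: "continuous_on (supp_interior \<kappa> S) b"
begin

abbreviation "\<nu> \<equiv> ref_measure \<kappa> S"

text \<open>The Laplace transform of \<open>b\<close>, that is, the exponential of the log partition
  function wherever that is finite.\<close>

definition M :: "real \<Rightarrow> ennreal" where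
  "M t = (\<integral>\<^sup>+ u. ennreal (b u * exp (u * t)) \<partial>\<nu>)"

text \<open>Nothing makes \<open>b\<close> measurable outside the support interior, hence the truncation.\<close>

definition b0 :: "real \<Rightarrow> real" where
  "b0 u = indicator (supp_interior \<kappa> S) u * b u"

lemma b0_measurable [measurable]: "b0 \<in> borel_measurable borel"
  unfolding b0_def by (rule borel_measurable_indicator_continuous[OF adm b_cont])

lemma b0_nonneg: "0 \<le> b0 u"
  using b_pos by (auto simp: b0_def indicator_def intro: less_imp_le)

lemma M_b0: "M t = (\<integral>\<^sup>+ u. ennreal (b0 u * exp (u * t)) \<partial>\<nu>)"
  unfolding M_def
  using AE_ref_measure_supp_interior[OF adm]
  by (intro nn_integral_cong_AE) (auto simp: b0_def elim!: eventually_mono)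

text \<open>The integrand is positive on the support interior, which has positive reference
  measure.\<close>

lemma M_pos: "0 < M t"
proof -
  have "\<not> (AE u in \<nu>. ennreal (b0 u * exp (u * t)) = 0)"
  proof
    assume "AE u in \<nu>. ennreal (b0 u * exp (u * t)) = 0"
    then have "AE u in \<nu>. u \<notin> supp_interior \<kappa> S"
    proof eventually_elim
      case (elim u)
      then show ?case
        using b_pos[of u] by (auto simp: b0_def ennreal_eq_0_iff mult_le_0_iff)
    qed
    then have "emeasure \<nu> (UNIV \<inter> supp_interior \<kappa> S) = 0"
      using supp_interior_borel[OF adm]
      by (subst (asm) AE_iff_measurable[OF _ refl]) (auto simp: sets_eq_imp_space_eq[OF sets_ref_measure])
    then show False
      using emeasure_ref_measure_open_pos[OF adm, of UNIV] supp_interior_two_points[OF adm] by auto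
  qed
  then show ?thesis
    by (simp add: M_b0 zero_less_iff_neq_zero nn_integral_0_iff_AE)
qed

lemma log_partition_finite_iff: "log_partition \<nu> b t < \<infinity> \<longleftrightarrow> M t < \<infinity>"
  by (auto simp: log_partition_def Let_def M_def less_top)

lemma log_partition_eq: "M t < \<infinity> \<Longrightarrow> log_partition \<nu> b t = ereal (ln (enn2real (M t)))"
  by (auto simp: log_partition_def Let_def M_def)

text \<open>Convexity of the exponential is integrated against the nonnegative weight
  \<open>b0\<close>.\<close>

lemma M_convex:
  assumes "0 \<le> r" "0 \<le> w" "r + w = 1"
  shows "M (r * s + w * t) \<le> ennreal r * M s + ennreal w * M t"
proof -
  have "ennreal (b0 u * exp (u * (r * s + w * t))) \<le>
      ennreal r * ennreal (b0 u * exp (u * s)) + ennreal w * ennreal (b0 u * exp (u * t))" for u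
  proof -
    have "convex_on UNIV (exp :: real \<Rightarrow> real)"
      by (rule exp_convex)
    then have "exp (r *\<^sub>R (u * s) + w *\<^sub>R (u * t)) \<le> r * exp (u * s) + w * exp (u * t)"
      using assms unfolding convex_on_def by blast
    then have "b0 u * exp (u * (r * s + w * t)) \<le> b0 u * (r * exp (u * s) + w * exp (u * t))"
      using b0_nonneg[of u] by (intro mult_left_mono) (auto simp: algebra_simps)
    also have "\<dots> = r * (b0 u * exp (u * s)) + w * (b0 u * exp (u * t))"
      by (simp add: algebra_simps)
    finally show ?thesis
      using assms b0_nonneg[of u] by (simp flip: ennreal_mult ennreal_plus)
  qed
  then have "M (r * s + w * t) \<le> (\<integral>\<^sup>+ u. ennreal r * ennreal (b0 u * exp (u * s)) +
      ennreal w * ennreal (b0 u * exp (u * t)) \<partial>\<nu>)"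
    unfolding M_b0 by (intro nn_integral_mono)
  also have "\<dots> = ennreal r * M s + ennreal w * M t"
    unfolding M_b0 by (simp add: nn_integral_add nn_integral_cmult)
  finally show ?thesis .
qed

lemma convex_M_finite: "convex {t. M t < \<infinity>}"
proof (rule convexI)
  fix s t r w :: real
  assume "s \<in> {t. M t < \<infinity>}" "t \<in> {t. M t < \<infinity>}" and rw: "0 \<le> r" "0 \<le> w" "r + w = 1"
  then have "ennreal r * M s + ennreal w * M t < \<infinity>"
    by (auto simp: ennreal_mult_less_top)
  with M_convex[OF rw, of s t] have "M (r * s + w * t) < \<infinity>"
    by (rule le_less_trans)
  then show "r *\<^sub>R s + w *\<^sub>R t \<in> {t. M t < \<infinity>}"
    by simp
qed

text \<open>A finite convex function on an open set is continuous, so no differentiation under the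
  integral is involved. Positivity of \<open>M\<close> then allows taking the logarithm.\<close>

lemma continuous_on_log_partition:
  "continuous_on (interior {t. log_partition \<nu> b t < \<infinity>}) (\<lambda>t. real_of_ereal (log_partition \<nu> b t))"
proof -
  let ?D = "interior {t. M t < \<infinity>}"
  have D: "M t < \<infinity>" if "t \<in> ?D" for t
    using that interior_subset by blast
  have "convex_on ?D (\<lambda>t. enn2real (M t))"
    unfolding convex_on_def
  proof (intro conjI ballI allI impI)
    show "convex ?D"
      by (intro convex_interior convex_M_finite)
    fix s t r w :: real
    assume st: "s \<in> ?D" "t \<in> ?D" and rw: "0 \<le> r" "0 \<le> w" "r + w = 1"
    have fin: "M s < \<infinity>" "M t < \<infinity>"
      using st D by auto
    then have "enn2real (M (r * s + w * t)) \<le> enn2real (ennreal r * M s + ennreal w * M t)"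
      by (intro enn2real_mono M_convex rw) (auto simp: ennreal_mult_less_top)
    also have "\<dots> = r * enn2real (M s) + w * enn2real (M t)"
      using fin rw by (simp add: enn2real_plus ennreal_mult_less_top enn2real_mult)
    finally show "enn2real (M (r *\<^sub>R s + w *\<^sub>R t)) \<le> r * enn2real (M s) + w * enn2real (M t)"
      by simp
  qed
  then have "continuous_on ?D (\<lambda>t. enn2real (M t))"
    by (rule convex_on_continuous[rotated]) simp
  moreover have "enn2real (M t) \<noteq> 0" if "t \<in> ?D" for t
    using D[OF that] M_pos[of t] by (auto simp: enn2real_eq_0_iff)
  ultimately have "continuous_on ?D (\<lambda>t. ln (enn2real (M t)))"
    by (intro continuous_on_ln) auto
  then show ?thesis
    unfolding log_partition_finite_iff
    by (rule continuous_on_eq) (subst log_partition_eq[OF D], auto)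
qed

lemma conditional_density_integral:
  assumes "log_partition \<nu> b t < \<infinity>"
  shows "(\<integral>\<^sup>+ u. ennreal (b u * exp (u * t - real_of_ereal (log_partition \<nu> b t))) \<partial>\<nu>) = 1"
proof -
  have fin: "M t < \<infinity>"
    using assms log_partition_finite_iff by blast
  define m where "m = enn2real (M t)"
  have m: "M t = ennreal m" "0 < m"
    using fin M_pos[of t] by (auto simp: m_def enn2real_positive_iff)
  have "(\<integral>\<^sup>+ u. ennreal (b u * exp (u * t - real_of_ereal (log_partition \<nu> b t))) \<partial>\<nu>) =
      (\<integral>\<^sup>+ u. ennreal (1 / m) * ennreal (b0 u * exp (u * t)) \<partial>\<nu>)"
    using AE_ref_measure_supp_interior[OF adm] fin m(2)
    by (intro nn_integral_cong_AE)
      (auto simp: b0_def log_partition_eq exp_diff m_def simp flip: ennreal_mult' elim!: eventually_mono)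
  also have "\<dots> = ennreal (1 / m) * M t"
    by (simp add: M_b0 nn_integral_cmult)
  also have "\<dots> = 1"
    using m by (simp flip: ennreal_mult)
  finally show ?thesis .
qed

end

subsection \<open>Densities of GLM DAGs\<close>

text \<open>The densities agree almost everywhere. If they differed at \<open>x\<close>, by
  continuity they would differ on a product neighbourhood of \<open>x\<close> in the box, whose
  measure is a product of positive factors.\<close>

lemma continuous_densities_agree:
  assumes adm: "\<And>j. j \<in> J \<Longrightarrow> admissible_support (\<kappa> j) (S j)" and J: "finite J"
    and meas: "p \<in> borel_measurable (PiM J (\<lambda>j. ref_measure (\<kappa> j) (S j)))"
      "p' \<in> borel_measurable (PiM J (\<lambda>j. ref_measure (\<kappa> j) (S j)))"
    and P: "P = density (PiM J (\<lambda>j. ref_measure (\<kappa> j) (S j))) (\<lambda>x. ennreal (p x))"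
      "P = density (PiM J (\<lambda>j. ref_measure (\<kappa> j) (S j))) (\<lambda>x. ennreal (p' x))"
    and "prob_space P"
    and pos: "\<And>x. x \<in> interior_box \<kappa> S J \<Longrightarrow> 0 < p x" "\<And>x. x \<in> interior_box \<kappa> S J \<Longrightarrow> 0 < p' x"
    and cont: "continuous_on (interior_box \<kappa> S J) p" "continuous_on (interior_box \<kappa> S J) p'"
    and x: "x \<in> interior_box \<kappa> S J"
  shows "p x = p' x"
proof (rule ccontr)
  assume neq: "p x \<noteq> p' x"
  let ?\<nu> = "PiM J (\<lambda>j. ref_measure (\<kappa> j) (S j))" and ?X = "interior_box \<kappa> S J"
  \<comment> \<open>\<open>product_sigma_finite\<close> constrains all indices, also those outside \<open>J\<close>.\<close>
  define R where "R j = (if j \<in> J then ref_measure (\<kappa> j) (S j) else lborel)" for j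
  have \<nu>R: "?\<nu> = PiM J R"
    by (rule PiM_cong) (auto simp: R_def)
  interpret product_sigma_finite R
  proof (rule product_sigma_finite.intro)
    show "sigma_finite_measure (R j)" for j
      using adm[of j] by (simp add: R_def lborel.sigma_finite_measure_axioms sigma_finite_ref_measure)
  qed
  interpret prob_space P by fact
  have "emeasure P (space P) = (\<integral>\<^sup>+ y. ennreal (p y) \<partial>?\<nu>)"
    unfolding P(1) using meas(1) by (simp add: emeasure_density)
  \<comment> \<open>Uniqueness of densities is applied in its version for a density of finite
    integral.\<close>
  then have "(\<integral>\<^sup>+ y. ennreal (p y) \<partial>?\<nu>) \<noteq> \<infinity>"
    by (simp add: emeasure_space_1)
  then have AE: "AE y in ?\<nu>. ennreal (p y) = ennreal (p' y)"
    using finite_density_unique[of "\<lambda>y. ennreal (p y)" ?\<nu> "\<lambda>y. ennreal (p' y)"] meas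
      trans[OF P(1)[symmetric] P(2)] by simp
  have "continuous_on ?X (\<lambda>y. p y - p' y)"
    using cont by (rule continuous_on_diff)
  then have "open (- {0 :: real}) \<longrightarrow> (\<exists>U. open U \<and> U \<inter> ?X = (\<lambda>y. p y - p' y) -` (- {0}) \<inter> ?X)"
    unfolding continuous_on_open_invariant by (rule spec[where x = "- {0}"])
  moreover have "open (- {0 :: real})"
    by auto
  ultimately obtain U where U: "open U" "U \<inter> ?X = (\<lambda>y. p y - p' y) -` (- {0}) \<inter> ?X"
    by blast
  have "x \<in> U"
    using U(2) x neq by auto
  then obtain Y where Y: "x \<in> PiE UNIV Y" "\<And>i. open (Y i)" "PiE UNIV Y \<subseteq> U"
    using product_topology_open_contains_basis[of "\<lambda>_. euclidean" UNIV U x] U(1)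
    by (auto simp: open_fun_def)
  define N where "N = (\<Pi>\<^sub>E j\<in>J. Y j \<inter> supp_interior (\<kappa> j) (S j))"
  have N: "y \<in> ?X" "p y \<noteq> p' y" if "y \<in> N" for y
  proof -
    show "y \<in> ?X"
      using that by (auto simp: N_def interior_box_def PiE_iff)
    \<comment> \<open>The set \<open>N\<close> constrains only coordinates in \<open>J\<close>;
      outside \<open>J\<close> both \<open>y\<close> and \<open>x\<close> take the value
      \<open>undefined\<close>.\<close>
    have "y i \<in> Y i" for i
    proof (cases "i \<in> J")
      case False
      then have "y i = x i"
        using that x by (auto simp: N_def interior_box_def PiE_iff extensional_def)
      then show ?thesis
        using Y(1) by (auto simp: PiE_iff)
    qed (use that in \<open>auto simp: N_def PiE_iff\<close>)
    then have "y \<in> U"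
      using Y(3) by (auto simp: PiE_iff)
    then show "p y \<noteq> p' y"
      using U(2) \<open>y \<in> ?X\<close> by auto
  qed
  have sets: "Y j \<inter> supp_interior (\<kappa> j) (S j) \<in> sets (R j)" if "j \<in> J" for j
    using that Y(2)[of j] supp_interior_borel[OF adm[OF that]] by (auto simp: R_def)
  have "AE y in ?\<nu>. y \<notin> N"
    using AE
  proof eventually_elim
    \<comment> \<open>Since \<open>ennreal\<close> sends all negative reals to zero, positivity is
      used to recover equality of the real values.\<close>
    case (elim y)
    then show ?case
      using N[of y] pos[of y] by auto
  qed
  moreover have N_sets: "N \<in> sets ?\<nu>"
    unfolding \<nu>R N_def using J sets by (intro sets_PiM_I_finite) auto
  moreover have "{y \<in> space ?\<nu>. \<not> y \<notin> N} = N"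
    using sets.sets_into_space[OF N_sets] by blast
  ultimately have "emeasure ?\<nu> N = 0"
    using AE_iff_measurable[of N ?\<nu> "\<lambda>y. y \<notin> N"] by blast
  moreover have "emeasure ?\<nu> N = (\<Prod>j\<in>J. emeasure (R j) (Y j \<inter> supp_interior (\<kappa> j) (S j)))"
    unfolding \<nu>R N_def using J sets by (rule emeasure_PiM)
  ultimately obtain j where j: "j \<in> J" "emeasure (R j) (Y j \<inter> supp_interior (\<kappa> j) (S j)) = 0"
    using J by auto
  have "x j \<in> Y j \<inter> supp_interior (\<kappa> j) (S j)"
    using Y(1) x j(1) by (auto simp: PiE_iff interior_box_def)
  then have "emeasure (ref_measure (\<kappa> j) (S j)) (Y j \<inter> supp_interior (\<kappa> j) (S j)) > 0"
    by (intro emeasure_ref_measure_open_pos adm j(1) Y(2)) auto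
  then show False
    using j by (simp add: R_def)
qed

section \<open>Node densities of a single GLM DAG\<close>

locale glm_dag =
  fixes d :: nat and \<kappa> :: "nat \<Rightarrow> var_kind" and S :: "nat \<Rightarrow> real set"
    and P :: "(nat \<Rightarrow> real) measure" and E :: "(nat \<times> nat) set"
    and f b :: "nat \<Rightarrow> real \<Rightarrow> real" and \<eta> :: "nat \<Rightarrow> (nat \<Rightarrow> real) \<Rightarrow> real"
  assumes supports: "\<And>j. j \<in> {1..d} \<Longrightarrow> admissible_support (\<kappa> j) (S j)"
    and dag: "dag d E"
    and glm: "semiparametric_glm_dag d \<kappa> S P E f b \<eta>"
    and nonlinear: "nonlinear_links \<kappa> S E \<eta>"
begin

abbreviation "I j \<equiv> supp_interior (\<kappa> j) (S j)"

abbreviation "X \<equiv> PiE {1..d} I"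

abbreviation "nd \<equiv> node_density \<kappa> S E f b \<eta>"

text \<open>A source is treated as a node whose base function is its density and whose natural
  parameter and cumulant are zero, so that one formula covers all nodes.\<close>

definition base :: "nat \<Rightarrow> real \<Rightarrow> real" where
  "base j = (if Pa E j = {} then f j else b j)"

definition param :: "nat \<Rightarrow> (nat \<Rightarrow> real) \<Rightarrow> real" where
  "param j x = (if Pa E j = {} then 0 else \<eta> j (restrict x (Pa E j)))"

definition cumulant :: "nat \<Rightarrow> (nat \<Rightarrow> real) \<Rightarrow> real" where
  "cumulant j x = (if Pa E j = {} then 0
     else real_of_ereal (log_partition (ref_measure (\<kappa> j) (S j)) (b j) (param j x)))"

lemma node_density_eq: "nd j x = base j (x j) * exp (x j * param j x - cumulant j x)"
  by (simp add: node_density_def base_def param_def cumulant_def Let_def)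

lemma Pa_subset: "Pa E j \<subseteq> {1..d}"
  using dag by (auto simp: dag_def Pa_def)

lemma Pa_irrefl: "j \<notin> Pa E j"
  using dag by (auto simp: dag_def Pa_def acyclic_def)

lemma node_regular:
  assumes "j \<in> {1..d}"
  shows "Pa E j = {} \<Longrightarrow> regular_source (\<kappa> j) (S j) (f j)"
    and "Pa E j \<noteq> {} \<Longrightarrow> regular_base (\<kappa> j) (S j) (b j)"
    and "Pa E j \<noteq> {} \<Longrightarrow> regular_natural_parameter \<kappa> S (Pa E j) (\<eta> j)
      (log_partition (ref_measure (\<kappa> j) (S j)) (b j))"
  using glm assms by (auto simp: semiparametric_glm_dag_def)

lemma base_density:
  assumes j: "j \<in> {1..d}"
  shows "base_density (\<kappa> j) (S j) (base j)"
proof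
  show adm: "admissible_support (\<kappa> j) (S j)"
    using j by (rule supports)
  have pos: "\<forall>u\<in>I j. 0 < base j u"
    and "\<kappa> j = Continuous \<longrightarrow> C2_on (\<lambda>u. ln (base j u)) (interior (S j))"
    using node_regular[OF j]
    by (cases "Pa E j = {}"; simp add: base_def regular_source_def regular_base_def)+
  with adm show "continuous_on (I j) (base j)"
    by (intro continuous_on_if_ln_C2)
  show "0 < base j u" if "u \<in> I j" for u
    using pos that by blast
qed

lemma param_cong: "(\<And>k. k \<in> Pa E j \<Longrightarrow> x k = y k) \<Longrightarrow> param j x = param j y"
  by (simp add: param_def cong: restrict_cong)

lemma cumulant_cong: "(\<And>k. k \<in> Pa E j \<Longrightarrow> x k = y k) \<Longrightarrow> cumulant j x = cumulant j y"
  using param_cong[of j x y] by (simp add: cumulant_def)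

lemma log_factors: "log_factors {1..d} I E param cumulant"
proof
  show "finite {1..d}" "E \<subseteq> {1..d} \<times> {1..d}" "acyclic E"
    using dag by (auto simp: dag_def)
  show "\<exists>u\<in>I j. \<exists>v\<in>I j. u \<noteq> v" if "j \<in> {1..d}" for j
    using supports[OF that] by (rule supp_interior_two_points)
  \<comment> \<open>Nonlinearity supplies values for the other parents only; \<open>w\<close> fills
    in the remaining coordinates. At \<open>k\<close> its value is overwritten by
    \<open>t\<close>.\<close>
  then obtain w where w: "\<And>j. j \<in> {1..d} \<Longrightarrow> w j \<in> I j"
    by metis
  show "param j x = param j y" if "\<And>k. k \<in> Pa E j \<Longrightarrow> x k = y k" for j x y
    using that by (rule param_cong)
  show "cumulant j x = cumulant j y" if "\<And>k. k \<in> Pa E j \<Longrightarrow> x k = y k" for j x y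
    using that by (rule cumulant_cong)
  show "\<exists>x\<in>X. \<not> (\<exists>\<alpha> c. \<forall>t\<in>I k. param i (x(k := t)) = \<alpha> * t + c)" if ki: "(k, i) \<in> E" for k i
  proof -
    obtain z where z: "z \<in> interior_box \<kappa> S (Pa E i - {k})"
        and na: "\<not> (\<exists>\<alpha> c. \<forall>t\<in>I k. \<eta> i (z(k := t)) = \<alpha> * t + c)"
      using nonlinear ki unfolding nonlinear_links_def by blast
    define x where "x m = (if m \<in> Pa E i - {k} then z m else if m \<in> {1..d} then w m else undefined)" for m
    have "x \<in> X"
      using z w Pa_subset[of i] by (auto simp: x_def interior_box_def PiE_iff extensional_def)
    moreover have "param i (x(k := t)) = \<eta> i (z(k := t))" for t
    proof -
      have "restrict (x(k := t)) (Pa E i) = z(k := t)"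
        using z ki by (auto simp: x_def interior_box_def PiE_iff extensional_def Pa_def restrict_def)
      then show ?thesis
        using ki by (auto simp: param_def Pa_def)
    qed
    ultimately show ?thesis
      using na by (intro bexI[of _ x]) simp_all
  qed
qed

sublocale log_factors "{1..d}" I E "\<lambda>j u. ln (base j u)" param cumulant
  by (rule log_factors)

lemma base_pos: "j \<in> {1..d} \<Longrightarrow> u \<in> I j \<Longrightarrow> 0 < base j u"
  using base_density base_density.b_pos by blast

lemma exp_q:
  assumes "x \<in> X" "j \<in> {1..d}"
  shows "exp (q j x) = nd j x"
  using base_pos[of j "x j"] PiE_mem[OF assms]  assms(2)
  by (simp add: q_def node_density_eq exp_add exp_diff)

lemma node_density_pos: "x \<in> X \<Longrightarrow> j \<in> {1..d} \<Longrightarrow> 0 < nd j x"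
  by (metis exp_q exp_gt_zero)

lemma param_in_domain:
  assumes "x \<in> X" "j \<in> {1..d}" "Pa E j \<noteq> {}"
  shows "param j x \<in> interior {t. log_partition (ref_measure (\<kappa> j) (S j)) (b j) t < \<infinity>}"
proof -
  have "restrict x (Pa E j) \<in> interior_box \<kappa> S (Pa E j)"
    using assms(1) Pa_subset[of j] by (auto simp: interior_box_def PiE_iff)
  then show ?thesis
    using node_regular(3)[OF assms(2,3)] assms(3)
    by (auto simp: regular_natural_parameter_def param_def)
qed

text \<open>The cumulant is continuous because the natural parameter stays in the interior of the
  domain of finiteness, where \<open>continuous_on_log_partition\<close> applies.\<close>

lemma continuous_on_node_density:
  assumes j: "j \<in> {1..d}"
  shows "continuous_on X (nd j)"
proof -
  interpret base_density "\<kappa> j" "S j" "base j"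
    using j by (rule base_density)
  have coord: "continuous_on X (\<lambda>x. x i)" for i
    by (rule continuous_on_subset[OF continuous_on_product_coordinates]) simp
  have param: "continuous_on X (param j)"
  proof (cases "Pa E j = {}")
    case True
    then show ?thesis
      by (simp add: param_def[abs_def])
  next
    case False
    have "continuous_on (interior_box \<kappa> S (Pa E j)) (\<eta> j)"
      using Pa_subset[of j] supports finite_subset[OF Pa_subset[of j]] node_regular(3)[OF j False]
      by (intro regular_natural_parameter_continuous) auto
    moreover have "continuous_on X (\<lambda>x. restrict x (Pa E j))"
    proof (rule continuous_on_coordinatewise_then_product)
      show "continuous_on X (\<lambda>x. restrict x (Pa E j) i)" for i
        using coord[of i] by (cases "i \<in> Pa E j") simp_all
    qed
    moreover have "(\<lambda>x. restrict x (Pa E j)) ` X \<subseteq> interior_box \<kappa> S (Pa E j)"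
      using Pa_subset[of j] by (auto simp: interior_box_def PiE_iff)
    ultimately have "continuous_on X (\<lambda>x. \<eta> j (restrict x (Pa E j)))"
      by (rule continuous_on_compose2)
    then show ?thesis
      using False by (simp add: param_def[abs_def])
  qed
  have "continuous_on X (cumulant j)"
  proof (cases "Pa E j = {}")
    case True
    then show ?thesis
      by (simp add: cumulant_def[abs_def])
  next
    case False
    have "continuous_on X (\<lambda>x. real_of_ereal (log_partition \<nu> (base j) (param j x)))"
      by (rule continuous_on_compose2[OF continuous_on_log_partition param])
        (use False in \<open>auto simp only: base_def if_False intro!: param_in_domain[OF _ j False]\<close>)
    then show ?thesis
      using False by (simp add: cumulant_def[abs_def] base_def)
  qed
  moreover have "continuous_on X (\<lambda>x. base j (x j))"
    using j by (intro continuous_on_compose2[OF b_cont coord] image_subsetI) (rule PiE_mem)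
  ultimately show ?thesis
    unfolding node_density_eq[abs_def] using param coord by (intro continuous_intros)
qed

lemma node_density_integral:
  assumes j: "j \<in> {1..d}" and x: "x \<in> X"
  shows "(\<integral>\<^sup>+ u. ennreal (nd j (x(j := u))) \<partial>ref_measure (\<kappa> j) (S j)) = 1"
proof -
  interpret base_density "\<kappa> j" "S j" "base j"
    using j by (rule base_density)
  have "param j (x(j := u)) = param j x" "cumulant j (x(j := u)) = cumulant j x" for u
    by (rule e_upd B_upd, rule Pa_irrefl)+
  then have nd: "nd j (x(j := u)) = base j u * exp (u * param j x - cumulant j x)" for u
    by (simp add: node_density_eq)
  show ?thesis
  proof (cases "Pa E j = {}")
    case True
    then have "regular_source (\<kappa> j) (S j) (base j)"
      using node_regular[OF j] by (simp add: base_def)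
    then show ?thesis
      using True unfolding nd by (simp add: param_def cumulant_def regular_source_def)
  next
    case False
    have "log_partition \<nu> (base j) (param j x) < \<infinity>"
      using param_in_domain[OF x j False] interior_subset False unfolding base_def by auto
    from conditional_density_integral[OF this] show ?thesis
      using False unfolding nd by (simp add: cumulant_def base_def)
  qed
qed

text \<open>Pulling a constant out of the integral in \<open>factors_normalized\<close> requires
  measurability, which continuity provides after truncation to the support interior.\<close>

lemma node_density_measurable:
  assumes j: "j \<in> {1..d}" and x: "x \<in> X"
  shows "(\<lambda>u. indicator (I j) u * nd j (x(j := u))) \<in> borel_measurable borel"
proof (rule borel_measurable_indicator_continuous)
  show "admissible_support (\<kappa> j) (S j)"
    using j by (rule supports)
  have "continuous_on (I j) (\<lambda>u. x(j := u))"
  proof (rule continuous_on_coordinatewise_then_product)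
    show "continuous_on (I j) (\<lambda>u. (x(j := u)) i)" for i
      by (cases "i = j") simp_all
  qed
  moreover have "(\<lambda>u. x(j := u)) ` I j \<subseteq> X"
    using x j by (auto simp: PiE_iff extensional_def)
  ultimately show "continuous_on (I j) (\<lambda>u. nd j (x(j := u)))"
    by (rule continuous_on_compose2[OF continuous_on_node_density[OF j]])
qed

text \<open>On the box the given density is prescribed as a product of continuous node densities,
  hence is continuous there.\<close>

lemma density:
  obtains p where "p \<in> borel_measurable (PiM {1..d} (\<lambda>j. ref_measure (\<kappa> j) (S j)))"
    "P = density (PiM {1..d} (\<lambda>j. ref_measure (\<kappa> j) (S j))) (\<lambda>x. ennreal (p x))"
    "\<And>x. x \<in> X \<Longrightarrow> 0 < p x" "\<And>x. x \<in> X \<Longrightarrow> p x = exp (\<Sum>j\<in>{1..d}. q j x)"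
    "continuous_on X p"
proof -
  obtain p where p: "p \<in> borel_measurable (PiM {1..d} (\<lambda>j. ref_measure (\<kappa> j) (S j)))"
    "P = density (PiM {1..d} (\<lambda>j. ref_measure (\<kappa> j) (S j))) (\<lambda>x. ennreal (p x))"
    and box: "\<forall>x\<in>X. 0 < p x \<and> p x = (\<Prod>j\<in>{1..d}. nd j x)"
    using conjunct1[OF glm[unfolded semiparametric_glm_dag_def]]
    unfolding glm_factorization_def Let_def interior_box_def by blast
  have "continuous_on X (\<lambda>x. \<Prod>j\<in>{1..d}. nd j x)"
    by (intro continuous_on_prod continuous_on_node_density)
  then have "continuous_on X p"
    by (rule continuous_on_eq) (use box in simp)
  moreover have "p x = exp (\<Sum>j\<in>{1..d}. q j x)" if "x \<in> X" for x
    using box that exp_q[OF that] by (simp add: exp_sum)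
  ultimately show thesis
    using that p box by blast
qed

end

section \<open>Two GLM DAGs with the same law\<close>

locale two_glm_dags =
  L: glm_dag d \<kappa> S P E f b \<eta> + R: glm_dag d \<kappa> S P E' f' b' \<eta>'
  for d \<kappa> S P E f b \<eta> E' f' b' \<eta>' +
  assumes prob_space_P: "prob_space P"
begin

sublocale two_log_factors "{1..d}" L.I
  E "\<lambda>j u. ln (L.base j u)" L.param L.cumulant
  E' "\<lambda>j u. ln (R.base j u)" R.param R.cumulant
  by unfold_locales

lemma log_densities_agree:
  assumes "x \<in> L.X"
  shows "(\<Sum>j\<in>{1..d}. L.q j x) = (\<Sum>j\<in>{1..d}. R.q j x)"
proof -
  obtain p where p: "p \<in> borel_measurable (PiM {1..d} (\<lambda>j. ref_measure (\<kappa> j) (S j)))"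
    "P = density (PiM {1..d} (\<lambda>j. ref_measure (\<kappa> j) (S j))) (\<lambda>x. ennreal (p x))"
    "\<And>x. x \<in> L.X \<Longrightarrow> 0 < p x" "\<And>x. x \<in> L.X \<Longrightarrow> p x = exp (\<Sum>j\<in>{1..d}. L.q j x)"
    "continuous_on L.X p"
    by (rule L.density) blast
  obtain p' where p': "p' \<in> borel_measurable (PiM {1..d} (\<lambda>j. ref_measure (\<kappa> j) (S j)))"
    "P = density (PiM {1..d} (\<lambda>j. ref_measure (\<kappa> j) (S j))) (\<lambda>x. ennreal (p' x))"
    "\<And>x. x \<in> L.X \<Longrightarrow> 0 < p' x" "\<And>x. x \<in> L.X \<Longrightarrow> p' x = exp (\<Sum>j\<in>{1..d}. R.q j x)"
    "continuous_on L.X p'"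
    by (rule R.density) blast
  have "p x = p' x"
    by (rule continuous_densities_agree[OF L.supports _ p(1) p'(1) p(2) p'(2) prob_space_P])
      (use p p' assms in \<open>auto simp: interior_box_def\<close>)
  then show ?thesis
    using p(4) p'(4) assms by simp
qed

text \<open>The two node densities differ by the factor \<open>exp c\<close> on the support
  interior, and both integrate to one over \<open>x j\<close>, so \<open>exp c = 1\<close>.\<close>

lemma factors_normalized:
  assumes j: "j \<in> {1..d}" and x: "x \<in> L.X"
    and eq: "\<And>u. u \<in> L.I j \<Longrightarrow> L.q j (x(j := u)) = R.q j (x(j := u)) + c"
  shows "c = 0"
proof -
  let ?\<nu> = "ref_measure (\<kappa> j) (S j)"
  have AE: "AE u in ?\<nu>. u \<in> L.I j"
    using j by (intro AE_ref_measure_supp_interior L.supports)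
  have "ennreal (L.nd j (x(j := u))) = ennreal (exp c) * ennreal (indicator (L.I j) u * R.nd j (x(j := u)))"
    if u: "u \<in> L.I j" for u
  proof -
    have xu: "x(j := u) \<in> L.X"
      using x u j by (auto simp: PiE_iff extensional_def)
    have "L.nd j (x(j := u)) = exp c * R.nd j (x(j := u))"
      using eq[OF u] by (simp flip: L.exp_q[OF xu j] R.exp_q[OF xu j] add: exp_add)
    then show ?thesis
      using u R.node_density_pos[OF xu j] by (simp flip: ennreal_mult)
  qed
  then have "(\<integral>\<^sup>+ u. ennreal (L.nd j (x(j := u))) \<partial>?\<nu>) =
      (\<integral>\<^sup>+ u. ennreal (exp c) * ennreal (indicator (L.I j) u * R.nd j (x(j := u))) \<partial>?\<nu>)"
    using AE by (intro nn_integral_cong_AE) (auto elim!: eventually_mono)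
  also have "\<dots> = ennreal (exp c) * (\<integral>\<^sup>+ u. ennreal (indicator (L.I j) u * R.nd j (x(j := u))) \<partial>?\<nu>)"
    using R.node_density_measurable[OF j x] by (intro nn_integral_cmult) simp
  also have "(\<integral>\<^sup>+ u. ennreal (indicator (L.I j) u * R.nd j (x(j := u))) \<partial>?\<nu>) =
      (\<integral>\<^sup>+ u. ennreal (R.nd j (x(j := u))) \<partial>?\<nu>)"
    using AE by (intro nn_integral_cong_AE) (auto elim!: eventually_mono)
  finally have "ennreal (exp c) = 1"
    by (simp only: L.node_density_integral[OF j x] R.node_density_integral[OF j x] mult_1_right)
  then show ?thesis
    by (simp flip: ennreal_1)
qed

lemma same_graph: "E' = E"
proof -
  have "\<forall>j\<in>{1..d}. Pa E j = Pa E' j"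
  proof (rule parents_eq)
    show "(\<Sum>j\<in>{1..d}. L.q j x) = (\<Sum>j\<in>{1..d}. R.q j x)" if "x \<in> L.X" for x
      using that by (rule log_densities_agree)
    show "c = 0" if "j \<in> {1..d}" "x \<in> L.X"
      "\<And>u. u \<in> L.I j \<Longrightarrow> L.q j (x(j := u)) = R.q j (x(j := u)) + c" for j x c
      using that by (rule factors_normalized)
  qed simp
  moreover have "Pa E j = {}" "Pa E' j = {}" if "j \<notin> {1..d}" for j
    using L.dag R.dag that by (auto simp: dag_def Pa_def)
  ultimately have "Pa E j = Pa E' j" for j
    by (cases "j \<in> {1..d}") auto
  then have "(k, j) \<in> E' \<longleftrightarrow> (k, j) \<in> E" for k j
    unfolding Pa_def by blast
  then show ?thesis
    by auto
qed

end

theorem corollary9: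
  fixes d :: nat
    and \<kappa> :: "nat \<Rightarrow> var_kind"
    and S :: "nat \<Rightarrow> real set"
    and P :: "(nat \<Rightarrow> real) measure"
    and G G' :: "(nat \<times> nat) set"
  assumes "coordinate_law d \<kappa> S P"
    and "dag d G" and "follows_nonlinear_glm_dag d \<kappa> S P G"
    and "dag d G'" and "follows_nonlinear_glm_dag d \<kappa> S P G'"
  shows "G' = G"
proof -
  obtain f b \<eta> where 1: "semiparametric_glm_dag d \<kappa> S P G f b \<eta>" "nonlinear_links \<kappa> S G \<eta>"
    using assms(3) by (auto simp: follows_nonlinear_glm_dag_def)
  obtain f' b' \<eta>' where 2: "semiparametric_glm_dag d \<kappa> S P G' f' b' \<eta>'" "nonlinear_links \<kappa> S G' \<eta>'"
    using assms(5) by (auto simp: follows_nonlinear_glm_dag_def)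
  have supports: "admissible_support (\<kappa> j) (S j)" if "j \<in> {1..d}" for j
    using assms(1) that by (simp add: coordinate_law_def)
  interpret two_glm_dags d \<kappa> S P G f b \<eta> G' f' b' \<eta>'
  proof (intro two_glm_dags.intro glm_dag.intro two_glm_dags_axioms.intro)
    show "prob_space P"
      using assms(1) by (simp add: coordinate_law_def)
  qed (fact supports assms 1 2)+
  show ?thesis
    by (rule same_graph)
qed

end
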